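(* For $n\ge1$ let $V_n:=\sum_{w\in\mathcal F_{n,2}}\mathrm{ver}(G(w))$ be the total number of vertices of all graphs $G(w)$, $w\in\mathcal F_{n,2}$, and let $D^{(2)}_n:=\sum_{w\in\mathcal F_{n,2}}\deg_2(G(w))$ be the total number of vertices of degree $2$ among them. Then $$\lim_{n\to\infty}\frac{D^{(2)}_n}{V_n}=\frac{7-\sqrt5}{22}.$$
   Context: $\mathcal F_{n,2}$ is the set of binary words $w=w_1\cdots w_n$ with no two consecutive $1$'s. $P(w)$ is the bargraph polyomino formed by the unit squares $[i-1,i]\times[j-1,j]$, $1\le i\le n$, $1\le j\le w_i+1$. $G(w)$ is the graph whose vertices are the corners of the cells of $P(w)$ and whose edges are the cell sides. $\mathrm{ver}(G)$ is the number of vertices of $G$ and $\deg_2(G)$ the number of vertices of degree $2$. *)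

theory Defs
  imports Complex_Main
begin

definition fib_words :: "nat \<Rightarrow> nat list set" where
  "fib_words n = {w. length w = n \<and> set w \<subseteq> {0, 1} \<and>
     (\<forall>i. Suc i < n \<longrightarrow> \<not> (w ! i = 1 \<and> w ! Suc i = 1))}"

text \<open>The unit square \<open>[i-1,i] \<times> [j-1,j]\<close> is represented by its upper right corner \<open>(i, j)\<close>.
  Letters of words are indexed from 1 in the mathematics but list positions from 0, so the
  letter \<open>w\<^sub>i\<close> is \<open>w ! (i - 1)\<close>. In all cells \<open>i, j \<ge> 1\<close>, so the
  subtractions never truncate.\<close>

definition polyomino :: "nat list \<Rightarrow> (nat \<times> nat) set" where
  "polyomino w = {(i, j). 1 \<le> i \<and> i \<le> length w \<and> 1 \<le> j \<and> j \<le> w ! (i - 1) + 1}"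

fun cell_corners :: "nat \<times> nat \<Rightarrow> (nat \<times> nat) set" where
  "cell_corners (i, j) = {(i - 1, j - 1), (i, j - 1), (i - 1, j), (i, j)}"

fun cell_sides :: "nat \<times> nat \<Rightarrow> (nat \<times> nat) set set" where
  "cell_sides (i, j) =
     {{(i - 1, j - 1), (i, j - 1)}, {(i - 1, j), (i, j)},
      {(i - 1, j - 1), (i - 1, j)}, {(i, j - 1), (i, j)}}"

definition verts :: "nat list \<Rightarrow> (nat \<times> nat) set" where
  "verts w = (\<Union>c\<in>polyomino w. cell_corners c)"

definition edges :: "nat list \<Rightarrow> (nat \<times> nat) set set" where
  "edges w = (\<Union>c\<in>polyomino w. cell_sides c)"

definition vertex_degree :: "nat list \<Rightarrow> nat \<times> nat \<Rightarrow> nat" where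
  "vertex_degree w v = card {e \<in> edges w. v \<in> e}"

definition ver :: "nat list \<Rightarrow> nat" where
  "ver w = card (verts w)"

definition deg2 :: "nat list \<Rightarrow> nat" where
  "deg2 w = card {v \<in> verts w. vertex_degree w v = 2}"

definition total_ver :: "nat \<Rightarrow> nat" where
  "total_ver n = (\<Sum>w\<in>fib_words n. ver w)"

definition total_deg2 :: "nat \<Rightarrow> nat" where
  "total_deg2 n = (\<Sum>w\<in>fib_words n. deg2 w)"

end

theory Submission
  imports Defs
begin

text \<open>
  Since no two 1's of \<open>w\<close> are adjacent, the cells in the second row are pairwise disjoint, so
  every letter 1 contributes exactly two vertices at height 2, both of degree 2. The vertices at
  heights 0 and 1 form a \<open>(n + 1) \<times> 2\<close> grid in which only the four corners can have degree 2.
  Hence, up to a bounded error per word, the ratio depends only on the average number of 1's per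
  letter, and the Fibonacci recurrence shows that this average tends to \<open>(5 - sqrt 5) / 10\<close>.
\<close>

subsection \<open>Vertices and degrees for a single word\<close>

definition one_positions :: "nat list \<Rightarrow> nat set" where
  "one_positions w = {k. k < length w \<and> w ! k = 1}"

text \<open>A 1 at list position \<open>k\<close> puts a second-row cell over the interval from
  \<open>k\<close> to \<open>k + 1\<close>, whose top corners are \<open>(k, 2)\<close> and
  \<open>(Suc k, 2)\<close>.\<close>

definition top_verts :: "nat list \<Rightarrow> (nat \<times> nat) set" where
  "top_verts w = (\<lambda>k. (k, 2)) ` (one_positions w \<union> Suc ` one_positions w)"

lemma finite_one_positions [simp]: "finite (one_positions w)"
  by (simp add: one_positions_def)

lemma finite_top_verts [simp]: "finite (top_verts w)"
  by (simp add: top_verts_def)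

lemma fib_words_nth:
  assumes "w \<in> fib_words n" "k < n"
  shows "w ! k = 0 \<or> w ! k = 1"
  using assms nth_mem unfolding fib_words_def by fastforce

lemma Suc_notin_one_positions:
  assumes "w \<in> fib_words n" "k \<in> one_positions w"
  shows "Suc k \<notin> one_positions w"
  using assms by (auto simp: fib_words_def one_positions_def)

text \<open>Indexing cells by the list position \<open>k\<close> instead of the column
  \<open>Suc k\<close> removes the truncated subtraction from all later corner and side
  computations.\<close>

lemma polyomino_fib_word:
  assumes "w \<in> fib_words n"
  shows "polyomino w = (\<lambda>k. (Suc k, 1)) ` {..<n} \<union> (\<lambda>k. (Suc k, 2)) ` one_positions w"
    (is "_ = ?R")
proof -
  have len: "length w = n"
    using assms by (simp add: fib_words_def)
  have "(a, b) \<in> polyomino w \<longleftrightarrow> (a, b) \<in> ?R" for a b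
  proof (cases a)
    case 0
    then show ?thesis by (auto simp: polyomino_def)
  next
    case (Suc k)
    show ?thesis
    proof (cases "k < n")
      case True
      have "1 \<le> b \<and> b \<le> 2 \<longleftrightarrow> b = 1 \<or> b = 2"
        by auto
      with fib_words_nth[OF assms True] True Suc len show ?thesis
        by (auto simp: polyomino_def one_positions_def image_iff)
    next
      case False
      with Suc len show ?thesis
        by (auto simp: polyomino_def one_positions_def)
    qed
  qed
  then show ?thesis by auto
qed

lemma verts_fib_word:
  assumes "w \<in> fib_words n" "n \<ge> 1"
  shows "verts w = {..n} \<times> {0, 1} \<union> top_verts w"
proof -
  \<comment> \<open>By \<open>K\<close>, the lower corners of second-row cells already lie in the
    grid. The next fact says that each abscissa up to \<open>n\<close> is the left or right end of
    some column.\<close>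
  have K: "one_positions w \<subseteq> {..<n}"
    using assms by (auto simp: fib_words_def one_positions_def)
  have "{..<n} \<union> Suc ` {..<n} = {..n}"
    using assms(2) by (auto simp: image_iff) (metis Suc_pred' lessThan_iff less_Suc_eq_le not_less_eq_eq not_gr0 le_eq_less_or_eq)
  then have n: "{..n} = {..<n} \<union> Suc ` {..<n}" ..
  show ?thesis
    unfolding verts_def polyomino_fib_word[OF assms(1)] n top_verts_def
    using K by (fastforce simp: numeral_2_eq_2)
qed

text \<open>A top corner shared by two second-row cells would force two adjacent 1's, so each 1
  contributes two corners of its own.\<close>

lemma card_top_verts:
  assumes "w \<in> fib_words n"
  shows "card (top_verts w) = 2 * card (one_positions w)"
proof -
  have "one_positions w \<inter> Suc ` one_positions w = {}"
    using Suc_notin_one_positions[OF assms] by auto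
  then have "card (one_positions w \<union> Suc ` one_positions w) = 2 * card (one_positions w)"
    by (simp add: card_Un_disjoint card_image)
  then show ?thesis
    unfolding top_verts_def by (subst card_image) (auto simp: inj_on_def)
qed

lemma ver_fib_word:
  assumes "w \<in> fib_words n" "n \<ge> 1"
  shows "ver w = 2 * (n + 1) + 2 * card (one_positions w)"
proof -
  have "({..n} \<times> {0, 1}) \<inter> top_verts w = {}"
    by (auto simp: top_verts_def)
  then show ?thesis
    unfolding ver_def verts_fib_word[OF assms]
    by (simp add: card_Un_disjoint card_top_verts[OF assms(1)] card_cartesian_product)
qed

section \<open>Edges and vertex degrees\<close>

lemma edges_fib_word:
  assumes "w \<in> fib_words n"
  shows "edges w = (\<Union>k<n. {{(k, 0), (Suc k, 0)}, {(k, 1), (Suc k, 1)},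
                              {(k, 0), (k, 1)}, {(Suc k, 0), (Suc k, 1)}}) \<union>
    (\<Union>k\<in>one_positions w. {{(k, 1), (Suc k, 1)}, {(k, 2), (Suc k, 2)},
                              {(k, 1), (k, 2)}, {(Suc k, 1), (Suc k, 2)}})"
  unfolding edges_def polyomino_fib_word[OF assms] by simp

lemma finite_edges_fib_word:
  assumes "w \<in> fib_words n"
  shows "finite (edges w)"
  unfolding edges_fib_word[OF assms] by simp

lemma edge_at_height_2E:
  assumes w: "w \<in> fib_words n" and e: "e \<in> edges w" "(i, 2) \<in> e"
  obtains (horizontal) m where "m \<in> one_positions w" "e = {(m, 2), (Suc m, 2)}" "i = m \<or> i = Suc m"
    | (vertical) "e = {(i, 1), (i, 2)}"
proof -
  from e(1) consider
      (low) m where "e \<in> {{(m, 0), (Suc m, 0)}, {(m, 1), (Suc m, 1)},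
        {(m, 0), (m, 1)}, {(Suc m, 0), (Suc m, 1)}}"
    | (high) m where "m \<in> one_positions w" "e \<in> {{(m, 1), (Suc m, 1)}, {(m, 2), (Suc m, 2)},
        {(m, 1), (m, 2)}, {(Suc m, 1), (Suc m, 2)}}"
    unfolding edges_fib_word[OF w] UN_iff Un_iff by metis
  then show ?thesis
  proof cases
    case low
    with e(2) show ?thesis by auto
  next
    case high
    with e(2) show ?thesis using horizontal[of m] vertical by auto
  qed
qed

text \<open>Exactly one vertical side goes down from the vertex, and exactly one horizontal side
  meets it because the second-row cell has no neighbour.\<close>

lemma degree_top_vert:
  assumes w: "w \<in> fib_words n" and v: "v \<in> top_verts w"
  shows "vertex_degree w v = 2"
proof -
  from v obtain k i where k: "k \<in> one_positions w" and v: "v = (i, 2)" and i: "i = k \<or> i = Suc k"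
    by (auto simp: top_verts_def)
  have "{e \<in> edges w. v \<in> e} = {{(k, 2), (Suc k, 2)}, {(i, 1), (i, 2)}}"
  proof (intro equalityI subsetI)
    fix e assume "e \<in> {e \<in> edges w. v \<in> e}"
    then have "e \<in> edges w" "(i, 2) \<in> e"
      using v by auto
    with w show "e \<in> {{(k, 2), (Suc k, 2)}, {(i, 1), (i, 2)}}"
    proof (cases rule: edge_at_height_2E)
      case (horizontal m)
      \<comment> \<open>Both \<open>m\<close> and \<open>k\<close> lie in {\<open>i - 1\<close>,
        \<open>i\<close>}, so if distinct they would be adjacent positions of 1's.\<close>
      have "m \<noteq> Suc k" "k \<noteq> Suc m"
        using Suc_notin_one_positions[OF w] k horizontal(1) by metis+
      then have "m = k"
        using horizontal(3) i by auto
      then show ?thesis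
        using horizontal(2) by simp
    qed simp
  next
    fix e :: "(nat \<times> nat) set"
    assume e: "e \<in> {{(k, 2), (Suc k, 2)}, {(i, 1), (i, 2)}}"
    then have "e \<in> {{(k, 1), (Suc k, 1)}, {(k, 2), (Suc k, 2)},
        {(k, 1), (k, 2)}, {(Suc k, 1), (Suc k, 2)}}"
      using i by auto
    with k have "e \<in> edges w"
      unfolding edges_fib_word[OF w] UN_iff Un_iff by metis
    then show "e \<in> {e \<in> edges w. v \<in> e}"
      using e i v by auto
  qed
  then show ?thesis
    by (simp add: vertex_degree_def doubleton_eq_iff)
qed

text \<open>The vertex has a left and a right neighbour at its own height and a vertical edge
  joining heights 0 and 1. This lower bound excludes degree 2.\<close>

lemma degree_inner_vert:
  assumes w: "w \<in> fib_words n" and i: "0 < i" "i < n" and j: "j \<in> {0, 1}"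
  shows "vertex_degree w (i, j) \<ge> 3"
proof -
  obtain k where k: "i = Suc k"
    using i by (cases i) auto
  let ?E = "{{(k, j), (i, j)}, {(i, j), (Suc i, j)}, {(i, 0), (i, 1)}}"
  have h: "{(m, j), (Suc m, j)} \<in> edges w" if "m < n" for m
    unfolding edges_fib_word[OF w] by (rule UnI1, rule UN_I[of m]) (use that j in auto)
  have "{(i, 0), (i, 1)} \<in> edges w"
    unfolding edges_fib_word[OF w] by (rule UnI1, rule UN_I[of i]) (use i in auto)
  then have "?E \<subseteq> {e \<in> edges w. (i, j) \<in> e}"
    using h[of k] h[of i] i j k by auto
  then have "card ?E \<le> vertex_degree w (i, j)"
    unfolding vertex_degree_def using finite_edges_fib_word[OF w] by (intro card_mono) auto
  moreover have "card ?E = 3"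
    using k by (simp add: doubleton_eq_iff card_insert_if)
  ultimately show ?thesis by simp
qed

text \<open>The slack 4 comes from the corners of the grid: \<open>(0, 1)\<close> and
  \<open>(n, 1)\<close> have degree 2 or 3 depending on the first and last letters. It is negligible
  against a vertex count linear in \<open>n\<close>.\<close>

lemma deg2_fib_word_bounds:
  assumes "w \<in> fib_words n" "n \<ge> 1"
  shows "2 * card (one_positions w) \<le> deg2 w" "deg2 w \<le> 2 * card (one_positions w) + 4"
proof -
  let ?D = "{v \<in> verts w. vertex_degree w v = 2}"
  let ?C = "{(0, 0), (n, 0), (0, 1), (n, 1)} :: (nat \<times> nat) set"
  have up: "?D \<subseteq> top_verts w \<union> ?C"
  proof
    fix v assume v: "v \<in> ?D"
    obtain i j where ij: "v = (i, j)" by fastforce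
    have "v \<in> {..n} \<times> {0, 1} \<or> v \<in> top_verts w"
      using v verts_fib_word[OF assms] by auto
    moreover have False if "0 < i" "i < n" "j \<in> {0, 1}"
      using degree_inner_vert[OF assms(1) that] v ij by simp
    ultimately show "v \<in> top_verts w \<union> ?C"
      using ij by (fastforce simp: le_less)
  qed
  have low: "top_verts w \<subseteq> ?D"
    using verts_fib_word[OF assms] degree_top_vert[OF assms(1)] by auto
  have fin: "finite ?D"
    using up by (rule finite_subset) simp
  show "2 * card (one_positions w) \<le> deg2 w"
    using card_mono[OF fin low] card_top_verts[OF assms(1)] by (simp add: deg2_def)
  have "card ?C \<le> 4"
    by (simp add: card_insert_if)
  moreover have "card ?D \<le> card (top_verts w) + card ?C"
    using card_mono[OF _ up] card_Un_le[of "top_verts w" ?C] by fastforce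
  ultimately show "deg2 w \<le> 2 * card (one_positions w) + 4"
    using card_top_verts[OF assms(1)] by (simp add: deg2_def)
qed

subsection \<open>Counting words and their 1's\<close>

definition total_ones :: "nat \<Rightarrow> nat" where
  "total_ones n = (\<Sum>w\<in>fib_words n. card (one_positions w))"

text \<open>\<open>count_list\<close> computes on \<open>#\<close>, which suits the recurrences that
  prepend letters.\<close>

lemma card_one_positions: "card (one_positions w) = count_list w 1"
  by (simp add: one_positions_def count_list_eq_length_filter length_filter_conv_card eq_commute)

lemma finite_fib_words [simp]: "finite (fib_words n)"
  by (rule finite_subset[OF _ finite_lists_length_eq[of "{0, 1}" n]])
     (auto simp: fib_words_def)

lemma fib_words_0: "fib_words 0 = {[]}"
  by (auto simp: fib_words_def)

lemma fib_words_1: "fib_words (Suc 0) = {[0], [1]}"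
  by (auto simp: fib_words_def length_Suc_conv)

lemma Cons_0_in_fib_words: "0 # w \<in> fib_words (Suc n) \<longleftrightarrow> w \<in> fib_words n"
  by (auto simp: fib_words_def nth_Cons split: nat.splits)

lemma Cons_1_in_fib_words:
  "1 # b # w \<in> fib_words (Suc (Suc n)) \<longleftrightarrow> b = 0 \<and> w \<in> fib_words n"
  using Cons_0_in_fib_words[of w n] by (auto simp: fib_words_def All_less_Suc2)

text \<open>A leading 0 leaves the rest free; a leading 1 forces a 0, after which the rest is
  free.\<close>

lemma fib_words_Suc_Suc:
  "fib_words (Suc (Suc n)) =
     (#) 0 ` fib_words (Suc n) \<union> (\<lambda>w. 1 # 0 # w) ` fib_words n" (is "_ = ?R")
proof (intro set_eqI iffI)
  fix w assume w: "w \<in> fib_words (Suc (Suc n))"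
  then obtain a b u where u: "w = a # b # u"
    by (auto simp: fib_words_def length_Suc_conv)
  have "a = 0 \<or> a = 1"
    using fib_words_nth[OF w, of 0] u by simp
  then show "w \<in> ?R"
    using w u Cons_0_in_fib_words[of "b # u"] Cons_1_in_fib_words[of b u] by auto
next
  fix w assume "w \<in> ?R"
  then show "w \<in> fib_words (Suc (Suc n))"
    using Cons_0_in_fib_words Cons_1_in_fib_words by auto
qed

lemma sum_fib_words_Suc_Suc:
  fixes f :: "nat list \<Rightarrow> nat"
  shows "sum f (fib_words (Suc (Suc n))) =
    (\<Sum>w\<in>fib_words (Suc n). f (0 # w)) + (\<Sum>w\<in>fib_words n. f (1 # 0 # w))"
  unfolding fib_words_Suc_Suc
  by (subst sum.union_disjoint) (auto simp: sum.reindex inj_on_def)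

lemma card_fib_words_Suc_Suc:
  "card (fib_words (Suc (Suc n))) = card (fib_words (Suc n)) + card (fib_words n)"
  using sum_fib_words_Suc_Suc[of "\<lambda>_. 1"] by simp

text \<open>The last term counts the leading 1's of the words beginning with 1, 0.\<close>

lemma total_ones_Suc_Suc:
  "total_ones (Suc (Suc n)) = total_ones (Suc n) + total_ones n + card (fib_words n)"
  unfolding total_ones_def card_one_positions sum_fib_words_Suc_Suc
  by (simp add: sum.distrib sum_Suc)

lemma fib_words_nonempty [simp]: "fib_words n \<noteq> {}"
proof -
  have "replicate n 0 \<in> fib_words n"
    by (auto simp: fib_words_def)
  then show ?thesis by auto
qed

lemma card_fib_words_pos: "card (fib_words n) > 0"
  by (simp add: card_gt_0_iff)

text \<open>The recurrence for \<open>total_ones\<close> is the Fibonacci one driven by a Fibonacci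
  sequence, so its solution has coefficients linear in \<open>n\<close>. The negative term is moved
  to the left to stay within the naturals.\<close>

lemma total_ones_closed_form:
  "5 * total_ones n + (n + 2) * card (fib_words (Suc n)) = (3 * n + 4) * card (fib_words n)"
proof (induction n rule: induct_nat_012)
  case 0
  show ?case by (simp add: total_ones_def fib_words_0 fib_words_1 card_one_positions)
next
  case 1
  show ?case
    by (simp add: total_ones_def card_fib_words_Suc_Suc fib_words_0 fib_words_1 card_one_positions)
next
  case (ge2 n)
  then show ?case
    by (simp add: total_ones_Suc_Suc card_fib_words_Suc_Suc algebra_simps)
qed

subsection \<open>Asymptotics\<close>

text \<open>The difference cancels the \<phi>-component of the Fibonacci recurrence and leaves a
  geometric sequence in the conjugate root \<open>1 - \<phi>\<close>. Its initial value is
  \<open>2 - \<phi>\<close>, from the counts 2 and 1.\<close>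

lemma card_fib_words_golden:
  fixes \<phi> :: real
  assumes "\<phi> ^ 2 = \<phi> + 1"
  shows "real (card (fib_words (Suc n))) - \<phi> * real (card (fib_words n)) = (2 - \<phi>) * (1 - \<phi>) ^ n"
proof (induction n)
  case 0
  show ?case by (simp add: fib_words_0 fib_words_1)
next
  case (Suc n)
  have "real (card (fib_words (Suc (Suc n)))) - \<phi> * real (card (fib_words (Suc n)))
      = (1 - \<phi>) * (real (card (fib_words (Suc n))) - \<phi> * real (card (fib_words n)))"
    unfolding card_fib_words_Suc_Suc of_nat_add using assms by algebra
  then show ?case
    using Suc by simp
qed

lemma card_fib_words_ratio:
  "(\<lambda>n. real (card (fib_words (Suc n))) / real (card (fib_words n))) \<longlonglongrightarrow> (1 + sqrt 5) / 2"
proof -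
  define \<phi> :: real where "\<phi> = (1 + sqrt 5) / 2"
  have sq: "\<phi> ^ 2 = \<phi> + 1"
    by (simp add: \<phi>_def power2_eq_square field_simps)
  \<comment> \<open>The first bound gives \<phi> < 2 and the second \<phi> > 1, so the conjugate
    root has modulus below 1.\<close>
  have "sqrt 5 < 3" "sqrt 5 > 1"
    by (auto intro: real_less_lsqrt real_less_rsqrt)
  then have psi: "\<bar>1 - \<phi>\<bar> < 1"
    by (simp add: \<phi>_def abs_if field_simps)
  let ?r = "\<lambda>n. real (card (fib_words (Suc n))) / real (card (fib_words n))"
  have lim: "(\<lambda>n. \<bar>2 - \<phi>\<bar> * \<bar>1 - \<phi>\<bar> ^ n) \<longlonglongrightarrow> 0"
    using tendsto_mult_right_zero[OF LIMSEQ_power_zero[of "\<bar>1 - \<phi>\<bar>"]] psi by simp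
  have "norm (?r n - \<phi>) \<le> \<bar>2 - \<phi>\<bar> * \<bar>1 - \<phi>\<bar> ^ n" for n
  proof -
    have F: "real (card (fib_words n)) \<ge> 1"
      using card_fib_words_pos[of n] by simp
    have "?r n - \<phi> = (2 - \<phi>) * (1 - \<phi>) ^ n / real (card (fib_words n))"
      unfolding card_fib_words_golden[OF sq, of n, symmetric] by (simp add: diff_divide_distrib)
    then have "norm (?r n - \<phi>) = \<bar>2 - \<phi>\<bar> * \<bar>1 - \<phi>\<bar> ^ n / real (card (fib_words n))"
      by (simp add: abs_mult power_abs)
    also have "\<dots> \<le> \<bar>2 - \<phi>\<bar> * \<bar>1 - \<phi>\<bar> ^ n / 1"
      using F by (intro divide_left_mono) auto
    finally show ?thesis by simp
  qed
  then have "(\<lambda>n. ?r n - \<phi>) \<longlonglongrightarrow> 0"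
    by (intro tendsto_0_le[OF lim, of _ 1]) simp
  then show ?thesis
    unfolding \<phi>_def[symmetric] by (rule LIM_zero_cancel)
qed

lemma ones_density:
  "(\<lambda>n. real (total_ones n) / (real n * real (card (fib_words n)))) \<longlonglongrightarrow> (5 - sqrt 5) / 10"
proof -
  let ?r = "\<lambda>n. real (card (fib_words (Suc n))) / real (card (fib_words n))"
  \<comment> \<open>This is \<open>total_ones_closed_form\<close> solved for
    \<open>total_ones n\<close> and divided by \<open>n * card (fib_words n)\<close>; the limit is
    (3 - \<phi>) / 5 with \<phi> the golden ratio.\<close>
  have "(\<lambda>n. (3 + 4 * (1 / real n) - (1 + 2 * (1 / real n)) * ?r n) / 5)
      \<longlonglongrightarrow> (3 + 4 * 0 - (1 + 2 * 0) * ((1 + sqrt 5) / 2)) / 5"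
    by (intro tendsto_intros lim_1_over_n card_fib_words_ratio) auto
  moreover have "(3 + 4 * 0 - (1 + 2 * 0) * ((1 + sqrt 5) / 2)) / 5 = (5 - sqrt 5) / 10"
    by (simp add: field_simps)
  moreover have "\<forall>\<^sub>F n in sequentially.
      (3 + 4 * (1 / real n) - (1 + 2 * (1 / real n)) * ?r n) / 5
      = real (total_ones n) / (real n * real (card (fib_words n)))"
    using eventually_gt_at_top[of 0]
  proof eventually_elim
    case (elim n)
    have "5 * real (total_ones n) + (real n + 2) * real (card (fib_words (Suc n)))
        = (3 * real n + 4) * real (card (fib_words n))"
      using arg_cong[OF total_ones_closed_form[of n], of real] by (simp add: algebra_simps)
    then have ones: "real (total_ones n) = ((3 * real n + 4) * real (card (fib_words n))
        - (real n + 2) * real (card (fib_words (Suc n)))) / 5"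
      by simp
    show ?case
      unfolding ones using elim card_fib_words_pos[of n] by (simp add: field_simps)
  qed
  ultimately show ?thesis
    by (simp only: Lim_transform_eventually)
qed

section \<open>Totals over all words and the limit of their ratio\<close>

lemma total_ver_eq:
  assumes "n \<ge> 1"
  shows "total_ver n = 2 * (n + 1) * card (fib_words n) + 2 * total_ones n"
proof -
  have "total_ver n = (\<Sum>w\<in>fib_words n. 2 * (n + 1) + 2 * card (one_positions w))"
    unfolding total_ver_def using assms by (intro sum.cong refl ver_fib_word)
  then show ?thesis
    unfolding sum.distrib by (simp add: total_ones_def sum_distrib_left)
qed

lemma total_deg2_bounds:
  assumes "n \<ge> 1"
  shows "2 * total_ones n \<le> total_deg2 n" "total_deg2 n \<le> 2 * total_ones n + 4 * card (fib_words n)"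
proof -
  have "(\<Sum>w\<in>fib_words n. 2 * card (one_positions w)) \<le> total_deg2 n"
    unfolding total_deg2_def using assms by (intro sum_mono deg2_fib_word_bounds)
  then show "2 * total_ones n \<le> total_deg2 n"
    by (simp add: total_ones_def sum_distrib_left)
  have "total_deg2 n \<le> (\<Sum>w\<in>fib_words n. 2 * card (one_positions w) + 4)"
    unfolding total_deg2_def using assms by (intro sum_mono deg2_fib_word_bounds)
  then show "total_deg2 n \<le> 2 * total_ones n + 4 * card (fib_words n)"
    by (simp add: sum.distrib total_ones_def sum_distrib_left)
qed

theorem theorem3p9:
  shows "(\<lambda>n. real (total_deg2 n) / real (total_ver n)) \<longlonglongrightarrow> (7 - sqrt 5) / 22"
proof -
  \<comment> \<open>\<open>N n\<close> is the total number of letters in all words of length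
    \<open>n\<close>; dividing by it gives numerator and denominator finite limits.\<close>
  define N where "N = (\<lambda>n. real n * real (card (fib_words n)))"
  define a where "a = (\<lambda>n. real (total_ones n) / N n)"
  have a: "a \<longlonglongrightarrow> (5 - sqrt 5) / 10"
    unfolding a_def N_def by (rule ones_density)
  have N: "N n > 0" if "n \<ge> 1" for n
    using that card_fib_words_pos[of n] by (simp add: N_def)
  have inv: "(\<lambda>n. 1 / real n) \<longlonglongrightarrow> 0"
    by (rule lim_1_over_n)
  have card_div: "real (card (fib_words n)) / N n = 1 / real n" if "n \<ge> 1" for n
    using that card_fib_words_pos[of n] by (simp add: N_def)
  have ver: "(\<lambda>n. real (total_ver n) / N n) \<longlonglongrightarrow> 2 * (1 + 0) + 2 * ((5 - sqrt 5) / 10)"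
  proof (rule Lim_transform_eventually)
    show "(\<lambda>n. 2 * (1 + 1 / real n) + 2 * a n) \<longlonglongrightarrow> 2 * (1 + 0) + 2 * ((5 - sqrt 5) / 10)"
      by (intro tendsto_intros a inv)
    show "\<forall>\<^sub>F n in sequentially. 2 * (1 + 1 / real n) + 2 * a n = real (total_ver n) / N n"
      using eventually_ge_at_top[of 1]
    proof eventually_elim
      case (elim n)
      then show ?case
        using card_fib_words_pos[of n] by (simp add: total_ver_eq a_def N_def field_simps)
    qed
  qed
  \<comment> \<open>The error of at most 4 per word becomes 4 / \<open>n\<close> after division by
    \<open>N n\<close>.\<close>
  have deg: "(\<lambda>n. real (total_deg2 n) / N n) \<longlonglongrightarrow> 2 * ((5 - sqrt 5) / 10)"
  proof (rule tendsto_sandwich)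
    show "(\<lambda>n. 2 * a n) \<longlonglongrightarrow> 2 * ((5 - sqrt 5) / 10)"
      by (intro tendsto_intros a)
    have "(\<lambda>n. 2 * a n + 4 * (1 / real n)) \<longlonglongrightarrow> 2 * ((5 - sqrt 5) / 10) + 4 * 0"
      by (intro tendsto_intros a inv)
    then show "(\<lambda>n. 2 * a n + 4 * (1 / real n)) \<longlonglongrightarrow> 2 * ((5 - sqrt 5) / 10)"
      by simp
    show "\<forall>\<^sub>F n in sequentially. 2 * a n \<le> real (total_deg2 n) / N n"
      using eventually_ge_at_top[of 1]
    proof eventually_elim
      case (elim n)
      have "2 * real (total_ones n) \<le> real (total_deg2 n)"
        using total_deg2_bounds(1)[OF elim] by linarith
      from divide_right_mono[OF this, of "N n"] N[OF elim] show ?case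
        by (simp add: a_def)
    qed
    show "\<forall>\<^sub>F n in sequentially. real (total_deg2 n) / N n \<le> 2 * a n + 4 * (1 / real n)"
      using eventually_ge_at_top[of 1]
    proof eventually_elim
      case (elim n)
      have "real (total_deg2 n) \<le> 2 * real (total_ones n) + 4 * real (card (fib_words n))"
        using total_deg2_bounds(2)[OF elim] by linarith
      from divide_right_mono[OF this, of "N n"] N[OF elim] card_div[OF elim, symmetric] show ?case
        by (simp add: a_def add_divide_distrib)
    qed
  qed
  have "sqrt 5 < 3"
    by (auto intro: real_less_lsqrt)
  then have nz: "2 * (1 + 0) + 2 * ((5 - sqrt 5) / 10) \<noteq> 0"
    by (simp add: field_simps)
  have "(\<lambda>n. (real (total_deg2 n) / N n) / (real (total_ver n) / N n))
      \<longlonglongrightarrow> (2 * ((5 - sqrt 5) / 10)) / (2 * (1 + 0) + 2 * ((5 - sqrt 5) / 10))"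
    by (rule tendsto_divide[OF deg ver nz])
  \<comment> \<open>The quotient is (5 - \<open>sqrt 5\<close>) / (15 - \<open>sqrt 5\<close>);
    multiplying both parts by 15 + \<open>sqrt 5\<close> gives (70 - 10 \<open>sqrt 5\<close>) /
    220.\<close>
  moreover have "(2 * ((5 - sqrt 5) / 10)) / (2 * (1 + 0) + 2 * ((5 - sqrt 5) / 10))
      = (7 - sqrt 5) / 22"
    using \<open>sqrt 5 < 3\<close> by (simp add: field_simps)
  moreover have "\<forall>\<^sub>F n in sequentially. (real (total_deg2 n) / N n) / (real (total_ver n) / N n)
      = real (total_deg2 n) / real (total_ver n)"
    using eventually_ge_at_top[of 1] by eventually_elim (use N in fastforce)
  ultimately show ?thesis
    by (simp only: Lim_transform_eventually)
qed

end
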